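(* Let $X$ be a Hausdorff locally convex topological vector space, let $K$ be a nonempty convex closed subset of $X$, let $D\subseteq K$ be a self segment-dense set in $K$, and let $F:K\times K\rightrightarrows\mathbb{R}$ be a set-valued map satisfying: (i) for all $y\in D$, the map $x\mapsto F(x,y)$ is lower semicontinuous on $K$; (ii) for all $x\in K$, the map $y\mapsto F(x,y)$ is lower semicontinuous on $K\setminus D$; (iii) for all $x\in D$, the map $y\mapsto F(x,y)$ is convex on $D$; (iv) for all $x\in D$, $F(x,x)\ge 0$; (v) there exist a compact set $K_0\subseteq X$ and $y_0\in D\cap K_0$ such that $F(x,y_0)\cap(-\infty,0)\neq\emptyset$ for all $x\in K\setminus K_0$. Then there exists $x_0\in K$ such that $F(x_0,y)\ge 0$ for all $y\in K$.
   Context: Self segment-dense: for $U\subseteq V\subseteq X$ with $V$ convex, $U$ is self segment-dense in $V$ if $U$ is dense in $V$ (i.e. $V\subseteq\operatorname{cl}(U)$) and for all $x,y\in U$ the set $[x,y]\cap U$ is dense in the closed segment $[x,y]=\{x+t(y-x):t\in[0,1]\}$. Notation: $F(x,y)\ge 0$ means $u\ge 0$ for all $u\in F(x,y)$. Lower semicontinuity: a set-valued map $T:A\rightrightarrows\mathbb{R}$ on a topological space $A$ (here $A=K$ with the subspace topology), with domain $D(T)=\{x\in A:T(x)\ne\emptyset\}$, is lower semicontinuous at $x\in D(T)$ if for every open $N\subseteq\mathbb{R}$ with $T(x)\cap N\neq\emptyset$ there is a neighborhood $M$ of $x$ in $A$ such that $T(y)\cap N\ne\emptyset$ for every $y\in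 M\cap D(T)$. It is lower semicontinuous on $S\subseteq A$ if it is lower semicontinuous at every point of $S$ (so in particular $S\subseteq D(T)$); here $T$ is still regarded as a map on all of $A$. Convexity on a not necessarily convex set: $T$ is convex on $D$ if for all $x_1,\dots,x_n\in D$ and $\lambda_i\ge0$ with $\sum_{i=1}^n\lambda_i=1$ and $\sum_{i=1}^n\lambda_ix_i\in D$ one has $\sum_{i=1}^n\lambda_iT(x_i)\subseteq T\left(\sum_{i=1}^n\lambda_ix_i\right)$ (Minkowski sum). *)

theory Defs
  imports "HOL-Analysis.Analysis"
begin

class topological_real_vector = real_vector + topological_ab_group_add +
  assumes tendsto_scaleR_nhds_Pair:
    "LIM p (nhds c \<times>\<^sub>F nhds x). fst p *\<^sub>R snd p :> nhds (c *\<^sub>R x)"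

text \<open>Hausdorffness is not part of the class; it is added through the sort \<^class>\<open>t2_space\<close>.\<close>

text \<open>
  Every neighbourhood of \<open>0\<close> contains a convex one. Convexity of \<open>C\<close> is spelled out because the
  constant \<^const>\<open>convex\<close> is not available inside a class specification; see the lemma below.
\<close>

class locally_convex_space = topological_real_vector +
  assumes convex_nhds_zero_raw:
    "open U \<Longrightarrow> 0 \<in> U \<Longrightarrow>
      \<exists>C W. (\<forall>x\<in>C. \<forall>y\<in>C. \<forall>u\<ge>0. \<forall>v\<ge>0. u + v = 1 \<longrightarrow> u *\<^sub>R x + v *\<^sub>R y \<in> C) \<and>
        open W \<and> 0 \<in> W \<and> W \<subseteq> C \<and> C \<subseteq> U"

lemma convex_nhds_zero:
  fixes U :: "'a::locally_convex_space set"
  assumes "open U" "0 \<in> U"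
  shows "\<exists>C. convex C \<and> 0 \<in> interior C \<and> C \<subseteq> U"
  using convex_nhds_zero_raw[OF assms] unfolding convex_def interior_def by blast

instance real_normed_vector \<subseteq> locally_convex_space
proof
  fix c :: real and x :: 'a
  show "LIM p (nhds c \<times>\<^sub>F nhds x). fst p *\<^sub>R snd p :> nhds (c *\<^sub>R x)"
    by (intro tendsto_scaleR filterlim_fst filterlim_snd)
next
  fix U :: "'a set"
  assume "open U" "0 \<in> U"
  then obtain e where "e > 0" "ball 0 e \<subseteq> U"
    by (auto simp: open_contains_ball)
  then show "\<exists>C W. (\<forall>x\<in>C. \<forall>y\<in>C. \<forall>u\<ge>0. \<forall>v\<ge>0. u + v = 1 \<longrightarrow> u *\<^sub>R x + v *\<^sub>R y \<in> C) \<and>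
      open W \<and> 0 \<in> W \<and> W \<subseteq> C \<and> C \<subseteq> U"
    unfolding convex_def[symmetric]
    by (intro exI[of _ "ball 0 e"]) simp
qed

definition self_segment_dense :: "'a::topological_real_vector set \<Rightarrow> 'a set \<Rightarrow> bool"
  where "self_segment_dense U V \<longleftrightarrow>
    convex V \<and> U \<subseteq> V \<and> V \<subseteq> closure U \<and>
    (\<forall>x\<in>U. \<forall>y\<in>U. closed_segment x y \<subseteq> closure (closed_segment x y \<inter> U))"

text \<open>
  A set-valued map \<open>T : A \<rightrightarrows> B\<close> is a function into sets, of which only the values at points of
  \<open>A\<close> matter; values may be empty.
\<close>

definition sv_domain :: "'a set \<Rightarrow> ('a \<Rightarrow> 'b set) \<Rightarrow> 'a set"
  where "sv_domain A T = {x \<in> A. T x \<noteq> {}}"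

definition sv_lsc_at ::
    "'a::topological_space set \<Rightarrow> ('a \<Rightarrow> 'b::topological_space set) \<Rightarrow> 'a \<Rightarrow> bool"
  where "sv_lsc_at A T x \<longleftrightarrow>
    x \<in> sv_domain A T \<and>
    (\<forall>N. open N \<longrightarrow> T x \<inter> N \<noteq> {} \<longrightarrow>
      (\<exists>M. openin (top_of_set A) M \<and> x \<in> M \<and> (\<forall>y \<in> M \<inter> sv_domain A T. T y \<inter> N \<noteq> {})))"

text \<open>
  Neighbourhoods are taken in \<open>A\<close>, not in \<open>S\<close>; so this is in general stronger than lower
  semicontinuity of the restriction of \<open>T\<close> to \<open>S\<close>.
\<close>

definition sv_lsc_on ::
    "'a::topological_space set \<Rightarrow> ('a \<Rightarrow> 'b::topological_space set) \<Rightarrow> 'a set \<Rightarrow> bool"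
  where "sv_lsc_on A T S \<longleftrightarrow> (\<forall>x\<in>S. sv_lsc_at A T x)"

text \<open>
  The set \<open>D\<close> need not be convex. The sum on the left of the inclusion is the Minkowski sum of
  the scaled sets, from \<^theory>\<open>HOL-Library.Set_Algebras\<close>.
\<close>

definition sv_convex_on ::
    "'a::real_vector set \<Rightarrow> ('a \<Rightarrow> 'b::real_vector set) \<Rightarrow> bool"
  where "sv_convex_on D T \<longleftrightarrow>
    (\<forall>(n::nat) (x :: nat \<Rightarrow> 'a) (l :: nat \<Rightarrow> real).
      (\<forall>i\<in>{1..n}. x i \<in> D \<and> 0 \<le> l i) \<longrightarrow> (\<Sum>i=1..n. l i) = 1 \<longrightarrow>
      (\<Sum>i=1..n. l i *\<^sub>R x i) \<in> D \<longrightarrow>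
      (\<Sum>i=1..n. (\<lambda>u. l i *\<^sub>R u) ` T (x i)) \<subseteq> T (\<Sum>i=1..n. l i *\<^sub>R x i))"

end

theory Submission
  imports Defs
begin

text \<open>
  For \<open>y \<in> D\<close> the set \<open>G y = {x \<in> K. F x y \<ge> 0}\<close> is closed by lower semicontinuity in \<open>x\<close>, and
  \<open>G y\<^sub>0\<close> is compact by coercivity. For finite \<open>B \<subseteq> D\<close>, a point of \<open>convex hull B \<inter> D\<close> outside
  all \<open>G y\<close> with \<open>y \<in> B\<close> would contradict convexity and \<open>F x x \<ge> 0\<close>; since \<open>D\<close> is self
  segment-dense, \<open>convex hull B \<inter> D\<close> is dense in \<open>convex hull B\<close>, so the \<open>G y\<close> cover the whole hull.
  The Knaster-Kuratowski-Mazurkiewicz theorem and compactness yield \<open>x\<^sub>0\<close> in all \<open>G y\<close>, \<open>y \<in> D\<close>, and lower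
  semicontinuity in \<open>y\<close> extends the inequality from the dense set \<open>D\<close> to \<open>K\<close>.

  The KKM theorem is obtained from Kuhn's combinatorial lemma on a grid in the cube, by sending the
  cube onto the simplex through the stick-breaking weights \<open>t\<^sub>i \<Prod>\<^sub>j\<^sub><\<^sub>i (1 - t\<^sub>j)\<close>.
\<close>

section \<open>Knaster-Kuratowski-Mazurkiewicz coverings of the cube\<close>

lemma tendsto_componentwise_fun:
  fixes f :: "'c \<Rightarrow> 'a \<Rightarrow> 'b::topological_space"
  shows "(f \<longlongrightarrow> l) F \<longleftrightarrow> (\<forall>i. ((\<lambda>c. f c i) \<longlongrightarrow> l i) F)"
  using limitin_componentwise[of "\<lambda>_. euclidean" UNIV f l F]
  by (simp add: euclidean_product_topology)

lemma compact_unit_cube: "compact {t :: nat \<Rightarrow> real. \<forall>i. t i \<in> {0..1}}"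
proof -
  have "compactin (product_topology (\<lambda>_. euclidean) UNIV) (PiE (UNIV :: nat set) (\<lambda>_. {0..1::real}))"
    by (subst compactin_PiE) auto
  then show ?thesis
    by (simp add: euclidean_product_topology PiE_UNIV_domain Pi_def)
qed

text \<open>
  The conditions on \<open>t i\<close> and \<open>t j\<close> say that the \<open>j\<close>-th stick-breaking weight of \<open>t\<close> is nonzero.
  Cubes live in \<^typ>\<open>nat \<Rightarrow> real\<close>, since the number of vertices varies; coordinates from \<open>n\<close> on
  play no role.
\<close>

lemma kkm_grid:
  fixes A :: "nat \<Rightarrow> (nat \<Rightarrow> real) set" and p n :: nat
  assumes cover: "\<And>t. \<forall>i. t i \<in> {0..1} \<Longrightarrow>
      \<exists>j\<le>n. t \<in> A j \<and> (\<forall>i<j. t i \<noteq> 1) \<and> (j < n \<longrightarrow> t j \<noteq> 0)"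
    and "p > 0"
  obtains b where "\<forall>i. b i \<in> {0..1}"
    "\<And>j. j \<le> n \<Longrightarrow> \<exists>a\<in>A j. \<forall>i. \<bar>a i - b i\<bar> \<le> 1 / real p"
proof -
  obtain J where J: "\<And>t. \<forall>i. t i \<in> {0..1} \<Longrightarrow>
      J t \<le> n \<and> t \<in> A (J t) \<and> (\<forall>i<J t. t i \<noteq> 1) \<and> (J t < n \<longrightarrow> t (J t) \<noteq> 0)"
    using cover by metis
  define g where "g x = (\<lambda>i. real (x i) / real p)" for x :: "nat \<Rightarrow> nat"
  \<comment> \<open>Chosen so that the first coordinate labelled 1 (or \<open>n\<close> if there is none) is \<open>J (g x)\<close>, within
    the boundary values that Kuhn's lemma prescribes.\<close>
  define lab where "lab x i =
    (if x i = 0 then 0 else if x i = p \<or> i = J (g x) then 1 else 0 :: nat)" for x i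
  have cube: "\<forall>i. g x i \<in> {0..1}" if "\<And>i. x i \<le> p" for x
    using that \<open>p > 0\<close> by (simp add: g_def)
  have red: "reduced n (lab x) = J (g x)" if "\<And>i. x i \<le> p" for x
  proof (rule reduced_labelling_unique)
    have Jx: "J (g x) \<le> n \<and> g x \<in> A (J (g x)) \<and> (\<forall>i<J (g x). g x i \<noteq> 1) \<and>
        (J (g x) < n \<longrightarrow> g x (J (g x)) \<noteq> 0)"
      using that by (intro J cube)
    show "J (g x) \<le> n" using Jx by blast
    have "x i \<noteq> p" if "i < J (g x)" for i
      using Jx that \<open>p > 0\<close> by (auto simp: g_def)
    then show "\<forall>i<J (g x). lab x i = 0"
      by (simp add: lab_def)
    show "J (g x) = n \<or> lab x (J (g x)) \<noteq> 0"
      using Jx by (auto simp: lab_def g_def)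
  qed
  \<comment> \<open>\<open>lab\<close> is 0 on the faces \<open>x i = 0\<close> and 1 on the faces
    \<open>x i = p\<close>, as Kuhn's lemma demands. An odd number of fully labelled simplices is at
    least one.\<close>
  have "odd (card {s. ksimplex p n s \<and> (reduced n \<circ> lab) ` s = {..n}})"
    using \<open>p > 0\<close> by (intro kuhn_combinatorial) (auto simp: lab_def)
  then obtain s base u where "kuhn_simplex p n base u s" and s: "(reduced n \<circ> lab) ` s = {..n}"
    by (metis (mono_tags, lifting) Collect_empty_eq odd_card_imp_not_empty ksimplex.cases)
  interpret kuhn_simplex p n base u s by fact
  show thesis
  proof (rule that[of "g base"])
    show "\<forall>i. g base i \<in> {0..1}"
      using cube s_le_p base_in_s by blast
    fix j assume "j \<le> n"
    then obtain x where x: "x \<in> s" "reduced n (lab x) = j"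
      using s by (metis atMost_iff comp_apply imageE)
    show "\<exists>a\<in>A j. \<forall>i. \<bar>a i - g base i\<bar> \<le> 1 / real p"
    proof (intro bexI allI)
      show "g x \<in> A j"
        using J[OF cube] red x s_le_p by metis
      \<comment> \<open>Each vertex of a Kuhn simplex exceeds its base by 0 or 1 in every
        coordinate.\<close>
      show "\<bar>g x i - g base i\<bar> \<le> 1 / real p" for i
        using base_le[OF x(1), of i] le_Suc_base[OF x(1), of i] \<open>p > 0\<close>
        by (simp add: g_def diff_divide_distrib[symmetric] divide_right_mono)
    qed
  qed
qed

text \<open>Grids of mesh \<open>1 / Suc k\<close> give points of all \<open>A j\<close> near a
  common \<open>b k\<close>. Along a convergent subsequence of \<open>b\<close> they share its
  limit, which closedness keeps in every \<open>A j\<close>.\<close>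

lemma kkm_cube:
  fixes A :: "nat \<Rightarrow> (nat \<Rightarrow> real) set"
  assumes cover: "\<And>t. \<forall>i. t i \<in> {0..1} \<Longrightarrow>
      \<exists>j\<le>n. t \<in> A j \<and> (\<forall>i<j. t i \<noteq> 1) \<and> (j < n \<longrightarrow> t j \<noteq> 0)"
    and closed: "\<And>j. j \<le> n \<Longrightarrow> closed (A j)"
  shows "\<exists>t. \<forall>j\<le>n. t \<in> A j"
proof -
  have "\<exists>b. (\<forall>i. b i \<in> {0..1}) \<and> (\<forall>j\<le>n. \<exists>a\<in>A j. \<forall>i. \<bar>a i - b i\<bar> \<le> 1 / real (Suc k))" for k
    using kkm_grid[OF cover, of "Suc k"] by (metis zero_less_Suc)
  then obtain b a where b: "\<And>k. \<forall>i. b k i \<in> {0..1}"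
    and a: "\<And>k j. j \<le> n \<Longrightarrow> a k j \<in> A j \<and> (\<forall>i. \<bar>a k j i - b k i\<bar> \<le> 1 / real (Suc k))"
    by metis
  obtain t r where r: "strict_mono r" and t: "(b \<circ> r) \<longlonglongrightarrow> t"
    by (rule seq_compactE[OF compact_imp_seq_compact[OF compact_unit_cube], of b]) (use b in auto)
  have "t \<in> A j" if "j \<le> n" for j
  proof (rule closed_sequentially[OF closed[OF that]])
    show "a (r k) j \<in> A j" for k
      using a[OF that] by blast
    have "(\<lambda>k. a (r k) j i) \<longlonglongrightarrow> t i" for i
    proof -
      have "(\<lambda>k. 1 / real (Suc (r k))) \<longlonglongrightarrow> 0"
        using LIMSEQ_subseq_LIMSEQ[OF LIMSEQ_Suc[OF lim_inverse_n'] r] by (simp add: o_def)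
      then have "(\<lambda>k. a (r k) j i - b (r k) i) \<longlonglongrightarrow> 0"
        by (rule Lim_null_comparison[rotated]) (use a[OF that] in auto)
      moreover have "(\<lambda>k. b (r k) i) \<longlonglongrightarrow> t i"
        using t by (simp add: tendsto_componentwise_fun o_def)
      ultimately show ?thesis
        using tendsto_add by fastforce
    qed
    then show "(\<lambda>k. a (r k) j) \<longlonglongrightarrow> t"
      by (simp add: tendsto_componentwise_fun)
  qed
  then show ?thesis by blast
qed

section \<open>The Knaster-Kuratowski-Mazurkiewicz theorem in topological vector spaces\<close>

lemma tendsto_scaleR_tvs [tendsto_intros]:
  fixes g :: "'b \<Rightarrow> 'a::topological_real_vector"
  assumes "(f \<longlongrightarrow> c) F" "(g \<longlongrightarrow> x) F"
  shows "((\<lambda>z. f z *\<^sub>R g z) \<longlongrightarrow> c *\<^sub>R x) F"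
  using filterlim_compose[OF tendsto_scaleR_nhds_Pair filterlim_Pair[OF assms]] by simp

lemma continuous_on_scaleR_tvs [continuous_intros]:
  fixes g :: "'b::topological_space \<Rightarrow> 'a::topological_real_vector"
  shows "continuous_on S f \<Longrightarrow> continuous_on S g \<Longrightarrow> continuous_on S (\<lambda>z. f z *\<^sub>R g z)"
  unfolding continuous_on_def by (blast intro: tendsto_scaleR_tvs)

text \<open>Telescoping: the product on the right is the part of the stick left after
  \<open>n\<close> breaks.\<close>

lemma sum_stick_breaking:
  fixes t :: "nat \<Rightarrow> 'a::comm_ring_1"
  shows "(\<Sum>i<n. t i * (\<Prod>j<i. 1 - t j)) = 1 - (\<Prod>j<n. 1 - t j)"
  by (induction n) (simp_all add: algebra_simps)

theorem KKM:
  fixes S :: "'a::topological_real_vector set"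
  assumes "finite S" "S \<noteq> {}"
    and closed: "\<And>y. y \<in> S \<Longrightarrow> closed (C y)"
    and cover: "\<And>B. B \<subseteq> S \<Longrightarrow> convex hull B \<subseteq> (\<Union>y\<in>B. C y)"
  shows "(\<Inter>y\<in>S. C y) \<noteq> {}"
proof -
  define n where "n = card S - 1"
  have "card S = Suc n"
    using assms by (simp add: n_def card_gt_0_iff)
  then obtain y where y: "bij_betw y {..n} S"
    using ex_bij_betw_nat_finite[OF \<open>finite S\<close>] by (metis atLeast0LessThan lessThan_Suc_atMost)
  \<comment> \<open>The last weight takes whatever is left of the stick, so the weights sum to
    1.\<close>
  define w where "w t i = (if i < n then t i else 1) * (\<Prod>j<i. 1 - t j)" for t :: "nat \<Rightarrow> real" and i
  define \<phi> where "\<phi> t = (\<Sum>i\<le>n. w t i *\<^sub>R y i)" for t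
  have w_sum: "(\<Sum>i\<le>n. w t i) = 1" for t
  proof -
    have "(\<Sum>i\<le>n. w t i) = (\<Sum>i<n. w t i) + w t n"
      by (simp add: lessThan_Suc_atMost[symmetric])
    also have "(\<Sum>i<n. w t i) = (\<Sum>i<n. t i * (\<Prod>j<i. 1 - t j))"
      by (rule sum.cong) (auto simp: w_def)
    finally show ?thesis by (simp add: sum_stick_breaking w_def)
  qed
  have cont: "continuous_on UNIV \<phi>"
  proof -
    have "continuous_on UNIV (\<lambda>t :: nat \<Rightarrow> real. if i < n then t i else 1)" for i
      by (cases "i < n") simp_all
    then show ?thesis
      unfolding \<phi>_def w_def by (intro continuous_intros) auto
  qed
  have "\<exists>t. \<forall>j\<le>n. t \<in> \<phi> -` C (y j)"
  proof (rule kkm_cube)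
    show "closed (\<phi> -` C (y j))" if "j \<le> n" for j
      using closed[of "y j"] y that cont
      by (intro closed_vimage) (auto simp: bij_betw_def)
  next
    fix t :: "nat \<Rightarrow> real" assume t: "\<forall>i. t i \<in> {0..1}"
    define I where "I = {i. i \<le> n \<and> w t i \<noteq> 0}"
    have I: "finite I" "I \<subseteq> {..n}" by (auto simp: I_def)
    have "\<phi> t = (\<Sum>i\<in>I. w t i *\<^sub>R y i)" "(\<Sum>i\<in>I. w t i) = 1"
      unfolding w_sum[of t, symmetric] \<phi>_def
      by (rule sum.mono_neutral_right sum.mono_neutral_left; auto simp: I_def)+
    moreover have "w t i \<ge> 0" for i
      using t by (auto simp: w_def intro!: mult_nonneg_nonneg prod_nonneg)
    ultimately have "\<phi> t \<in> convex hull (y ` I)"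
      by (simp, intro convex_sum[OF I(1) convex_convex_hull]) (auto intro: hull_inc)
    moreover have "y ` I \<subseteq> S"
      using y I(2) by (auto simp: bij_betw_def)
    ultimately obtain j where "j \<in> I" "\<phi> t \<in> C (y j)"
      using cover by blast
    then have "j \<le> n" "w t j \<noteq> 0" "\<phi> t \<in> C (y j)"
      by (auto simp: I_def)
    moreover from this have "\<forall>i<j. t i \<noteq> 1" "j < n \<longrightarrow> t j \<noteq> 0"
      by (auto simp: w_def)
    ultimately show "\<exists>j\<le>n. t \<in> \<phi> -` C (y j) \<and> (\<forall>i<j. t i \<noteq> 1) \<and> (j < n \<longrightarrow> t j \<noteq> 0)"
      by auto
  qed
  then show ?thesis
    using y by (fastforce simp: bij_betw_def)
qed

section \<open>Self segment-dense sets and set-valued maps\<close>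

lemma self_segment_dense_convex_hull:
  assumes U: "self_segment_dense U V" and "finite S" "S \<subseteq> U"
  shows "convex hull S \<subseteq> closure (convex hull S \<inter> U)"
  using assms(2,3)
proof (induction S)
  case empty
  then show ?case by simp
next
  case (insert a S)
  show ?case
  proof (cases "S = {}")
    case True
    then show ?thesis using insert by (simp add: closure_subset[THEN subsetD])
  next
    case False
    let ?H = "convex hull (insert a S)"
    \<comment> \<open>For \<open>b\<close> in \<open>U\<close> both ends of the segment lie in
      \<open>U\<close>, so density along segments applies. General \<open>b\<close> follow from the
      induction hypothesis and continuity.\<close>
    have seg: "u *\<^sub>R a + v *\<^sub>R b \<in> closure (?H \<inter> U)"
      if uv: "u \<ge> 0" "v \<ge> 0" "u + v = 1" and b: "b \<in> convex hull S \<inter> U" for u v b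
    proof -
      have b': "b \<in> ?H"
        using b hull_mono[of S "insert a S" convex] by auto
      then have sub: "closed_segment a b \<subseteq> ?H"
        by (intro closed_segment_subset convex_convex_hull) (auto simp: hull_inc)
      have "u *\<^sub>R a + v *\<^sub>R b \<in> closed_segment a b"
        using uv(1,2) eq_diff_eq[THEN iffD2, OF uv(3)] by (auto simp: closed_segment_def intro!: exI[of _ v] simp: algebra_simps simp flip: scaleR_left_distrib)
      also have "\<dots> \<subseteq> closure (closed_segment a b \<inter> U)"
        using U insert.prems b by (auto simp: self_segment_dense_def)
      also have "\<dots> \<subseteq> closure (?H \<inter> U)"
        using sub by (intro closure_mono) auto
      finally show ?thesis .
    qed
    show ?thesis
    proof
      fix x assume "x \<in> ?H"
      then obtain u v b where uv: "u \<ge> 0" "v \<ge> 0" "u + v = 1"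
        and b: "b \<in> convex hull S" and x: "x = u *\<^sub>R a + v *\<^sub>R b"
        by (auto simp: convex_hull_insert[OF False])
      have "b \<in> closure (convex hull S \<inter> U)"
        using insert b by auto
      moreover have "(\<lambda>b. u *\<^sub>R a + v *\<^sub>R b) ` closure (convex hull S \<inter> U) \<subseteq> closure (?H \<inter> U)"
        using seg uv by (intro image_closure_subset) (auto intro!: continuous_intros)
      ultimately show "x \<in> closure (?H \<inter> U)"
        unfolding x by blast
    qed
  qed
qed

text \<open>Lower semicontinuity at every point of \<open>A\<close> forces \<open>T\<close> to be
  nonempty-valued there, so its domain is \<open>A\<close> and the complement is open.\<close>

lemma closedin_sv_lsc_on:
  assumes lsc: "sv_lsc_on A T A" and "open N"
  shows "closedin (top_of_set A) {x \<in> A. T x \<inter> N = {}}"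
proof -
  have dom: "sv_domain A T = A"
    using lsc by (auto simp: sv_lsc_on_def sv_lsc_at_def sv_domain_def)
  have "\<exists>M. openin (top_of_set A) M \<and> x \<in> M \<and> M \<subseteq> {x \<in> A. T x \<inter> N \<noteq> {}}"
    if x: "x \<in> A" "T x \<inter> N \<noteq> {}" for x
  proof -
    obtain M where "openin (top_of_set A) M" "x \<in> M" "\<forall>y\<in>M \<inter> A. T y \<inter> N \<noteq> {}"
      using lsc x \<open>open N\<close> unfolding sv_lsc_on_def sv_lsc_at_def dom by meson
    moreover from this have "M \<subseteq> A"
      using openin_imp_subset by blast
    ultimately show ?thesis
      by blast
  qed
  then have "openin (top_of_set A) {x \<in> A. T x \<inter> N \<noteq> {}}"
    by (subst openin_subopen) auto
  moreover have "A - {x \<in> A. T x \<inter> N = {}} = {x \<in> A. T x \<inter> N \<noteq> {}}"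
    by auto
  ultimately show ?thesis
    by (simp add: closedin_def)
qed

text \<open>A convex combination of negative elements of the \<open>T y\<close> is negative, and
  convexity places it in \<open>T x\<close>.\<close>

lemma sv_convex_on_hull_neg:
  fixes T :: "'a::real_vector \<Rightarrow> real set"
  assumes conv: "sv_convex_on D T" and "S \<subseteq> D" and x: "x \<in> convex hull S" "x \<in> D"
    and neg: "\<And>y. y \<in> S \<Longrightarrow> T y \<inter> {..<0} \<noteq> {}"
  shows "T x \<inter> {..<0} \<noteq> {}"
proof -
  obtain k l y where l: "\<forall>i\<in>{1::nat..k}. 0 \<le> l i \<and> y i \<in> S" "sum l {1..k} = 1"
    and x_eq: "(\<Sum>i=1..k. l i *\<^sub>R y i) = x"
    using x(1) by (auto simp: convex_hull_indexed)
  have "\<forall>i\<in>{1..k}. \<exists>v. v \<in> T (y i) \<and> v < 0"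
    using neg l(1) by fastforce
  then obtain u where u: "\<And>i. i \<in> {1..k} \<Longrightarrow> u i \<in> T (y i) \<and> u i < 0"
    by (metis (lifting) bchoice)
  have "(\<Sum>i=1..k. (\<lambda>v. l i *\<^sub>R v) ` T (y i)) \<subseteq> T x"
    using conv l x(2) x_eq \<open>S \<subseteq> D\<close> unfolding sv_convex_on_def by blast
  moreover have "(\<Sum>i=1..k. l i *\<^sub>R u i) \<in> (\<Sum>i=1..k. (\<lambda>v. l i *\<^sub>R v) ` T (y i))"
    using u by (subst set_sum_alt) (auto intro!: exI[of _ "\<lambda>i. l i *\<^sub>R u i"])
  moreover have "(\<Sum>i=1..k. l i *\<^sub>R u i) < 0"
  proof -
    obtain i where i: "i \<in> {1..k}" "l i \<noteq> 0"
      using l(2) by (metis sum.neutral zero_neq_one)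
    have "0 < (\<Sum>i=1..k. l i * (- u i))"
    proof (rule sum_pos2[OF _ i(1)])
      show "0 < l i * (- u i)"
        using i l(1) u[OF i(1)] by (intro mult_pos_pos) (auto simp: less_le)
      show "0 \<le> l j * (- u j)" if "j \<in> {1..k}" for j
        using that l(1) u[OF that] by (intro mult_nonneg_nonneg) auto
    qed simp
    then show ?thesis by (simp add: sum_negf)
  qed
  ultimately show ?thesis by blast
qed

section \<open>Existence of an equilibrium point\<close>

theorem theorem4p1:
  fixes K D :: "'a :: {locally_convex_space, t2_space} set"
    and F :: "'a \<Rightarrow> 'a \<Rightarrow> real set"
  assumes "K \<noteq> {}" and "convex K" and "closed K"
    and "D \<subseteq> K" and "self_segment_dense D K"
    and "\<forall>y\<in>D. sv_lsc_on K (\<lambda>x. F x y) K"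
    and "\<forall>x\<in>K. sv_lsc_on K (\<lambda>y. F x y) (K - D)"
    and "\<forall>x\<in>D. sv_convex_on D (\<lambda>y. F x y)"
    and "\<forall>x\<in>D. \<forall>u\<in>F x x. u \<ge> 0"
    and "\<exists>K\<^sub>0 y\<^sub>0. compact K\<^sub>0 \<and> y\<^sub>0 \<in> D \<inter> K\<^sub>0 \<and> (\<forall>x\<in>K - K\<^sub>0. F x y\<^sub>0 \<inter> {..<0} \<noteq> {})"
  shows "\<exists>x\<^sub>0\<in>K. \<forall>y\<in>K. \<forall>u\<in>F x\<^sub>0 y. u \<ge> 0"
proof -
  define G where "G y = {x \<in> K. F x y \<inter> {..<0} = {}}" for y
  have closed_G: "closed (G y)" if "y \<in> D" for y
    unfolding G_def
    by (rule closedin_closed_trans[OF closedin_sv_lsc_on \<open>closed K\<close>]) (use assms(6) that in auto)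
  have cover: "convex hull B \<subseteq> (\<Union>y\<in>B. G y)" if "finite B" "B \<subseteq> D" for B
  proof -
    \<comment> \<open>Convexity of \<open>F x\<close> is given only for \<open>x\<close> in
      \<open>D\<close>. The rest of the hull is reached by closure, a finite union of the closed
      \<open>G y\<close> being closed.\<close>
    have "convex hull B \<inter> D \<subseteq> (\<Union>y\<in>B. G y)"
    proof (rule ccontr)
      assume "\<not> ?thesis"
      then obtain x where x: "x \<in> convex hull B" "x \<in> D" "\<And>y. y \<in> B \<Longrightarrow> x \<notin> G y"
        by blast
      have "F x x \<inter> {..<0} \<noteq> {}"
      proof (rule sv_convex_on_hull_neg[where S = B and D = D and T = "F x"])
        show "sv_convex_on D (F x)" using assms(8) x(2) by blast
        show "F x y \<inter> {..<0} \<noteq> {}" if "y \<in> B" for y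
          using x(2) x(3)[OF that] assms(4) by (auto simp: G_def)
      qed (use x that in auto)
      then show False
        using assms(9) x(2) by (metis disjoint_iff lessThan_iff not_le)
    qed
    then have "closure (convex hull B \<inter> D) \<subseteq> (\<Union>y\<in>B. G y)"
      using that closed_G by (intro closure_minimal) auto
    with self_segment_dense_convex_hull[OF assms(5) that] show ?thesis by blast
  qed
  have finite_inter: "(\<Inter>y\<in>S. G y) \<noteq> {}" if "finite S" "S \<noteq> {}" "S \<subseteq> D" for S
  proof (rule KKM)
    show "convex hull B \<subseteq> (\<Union>y\<in>B. G y)" if "B \<subseteq> S" for B
      using \<open>finite S\<close> \<open>S \<subseteq> D\<close> that by (intro cover) (auto intro: finite_subset)
  qed (use that closed_G in auto)
  obtain K\<^sub>0 y\<^sub>0 where K0: "compact K\<^sub>0" and y0: "y\<^sub>0 \<in> D"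
    and coercive: "\<And>x. x \<in> K - K\<^sub>0 \<Longrightarrow> F x y\<^sub>0 \<inter> {..<0} \<noteq> {}"
    using assms(10) by blast
  have "G y\<^sub>0 \<subseteq> K\<^sub>0"
    using coercive by (auto simp: G_def)
  then have "compact (G y\<^sub>0)"
    using compact_Int_closed[OF K0 closed_G[OF y0]] by (simp add: inf.absorb2)
  then have "G y\<^sub>0 \<inter> \<Inter>(G ` D) \<noteq> {}"
  proof (rule compact_imp_fip_image)
    show "closed (G y)" if "y \<in> D" for y
      using that by (rule closed_G)
    \<comment> \<open>Adding \<open>y\<^sub>0\<close> to \<open>I\<close> absorbs the factor
      \<open>G y\<^sub>0\<close> and makes the index set nonempty.\<close>
    show "G y\<^sub>0 \<inter> \<Inter>(G ` I) \<noteq> {}" if "finite I" "I \<subseteq> D" for I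
      using finite_inter[of "insert y\<^sub>0 I"] that y0 by simp
  qed
  then obtain x\<^sub>0 where x0: "x\<^sub>0 \<in> K" "\<And>y. y \<in> D \<Longrightarrow> F x\<^sub>0 y \<inter> {..<0} = {}"
    by (auto simp: G_def)
  have "F x\<^sub>0 y \<inter> {..<0} = {}" if "y \<in> K" for y
  proof (rule ccontr)
    assume neg: "\<not> ?thesis"
    \<comment> \<open>The claim already holds on \<open>D\<close>, so semicontinuity in the second
      variable is needed only at points of \<open>K - D\<close>.\<close>
    with x0 that have "y \<in> K - D" by blast
    then have "sv_lsc_at K (F x\<^sub>0) y"
      using assms(7) x0(1) by (auto simp: sv_lsc_on_def)
    then obtain M where M: "openin (top_of_set K) M" "y \<in> M"
      "\<forall>z\<in>M \<inter> sv_domain K (F x\<^sub>0). F x\<^sub>0 z \<inter> {..<0} \<noteq> {}"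
      using neg unfolding sv_lsc_at_def by (metis open_lessThan)
    then obtain W where W: "open W" "M = K \<inter> W"
      by (auto simp: openin_open)
    have "y \<in> closure D"
      using assms(5) that by (auto simp: self_segment_dense_def)
    then obtain z where z: "z \<in> D" "z \<in> W"
      using W M(2) by (auto simp: closure_iff_nhds_not_empty)
    \<comment> \<open>Since \<open>z\<close> is in \<open>D\<close>, semicontinuity in the first
      variable at \<open>x\<^sub>0\<close> includes nonemptiness of
      \<open>F x\<^sub>0 z\<close>.\<close>
    have "z \<in> sv_domain K (F x\<^sub>0)"
      using assms(4,6) z(1) x0(1)
      by (auto simp: sv_lsc_on_def sv_lsc_at_def sv_domain_def)
    then show False
      using M(3) W z x0(2) assms(4) by blast
  qed
  with x0(1) show ?thesis
    by (metis disjoint_iff lessThan_iff not_le)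
qed

end
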